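(* Let $m,s\ge1$ be integers and let $q$ be a fixed prime. Let $\mathbb N_q$ be the set of positive integers all of whose prime factors are larger than $q$. Let $\{A_x\}_{x\in(0,\infty)}$ be finite sets with $A_x\subseteq A_y$ for $x\le y$ and with $A=\bigcup_xA_x$ infinite, let $n:A\to\mathbb N$ be a function, and for integers $\delta\ge1$ put $\pi(x,\delta)=\#\{a\in A_x:n(a)\equiv0\pmod\delta\}$. Let $\varrho:\mathbb N_q\to\mathbb R_{>0}$ be a function such that (L-1) for all $x\ge2$, $$\sum_{\substack{d_1,\dots,d_m\le x\\ \delta:=\mathrm{lcm}(d_1,\dots,d_m)\in\mathbb N_q}}\frac1{\varrho(\delta)}\gg(\log x)^{s(2^m-1)}.$$ Assume (L) there exists $c_1\in(0,1)$ such that $\pi(x,\delta)\gg\frac{1}{\varrho(\delta)}\#A_x$ whenever $\delta\in\mathbb N_q$ and $1\le\delta\le x^{c_1}$ (implied constant independent of $x,\delta$). Then $$\sum_{a\in A_x}d(n(a))^m\gg\#A_x\,(\log x)^{s(2^m-1)}$$ for all sufficiently large $x$.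
   Context: $d(n)$ is the number of positive divisors of $n$. In the sum in (L-1), $d_1,\dots,d_m$ run over positive integers. *)

theory Defs
  imports Complex_Main "HOL-Library.FuncSet" "HOL-Computational_Algebra.Primes"
begin

definition divisor_count :: "nat \<Rightarrow> nat" where
  "divisor_count n = card {k. k dvd n}"

definition rough_nats :: "nat \<Rightarrow> nat set" where
  "rough_nats q = {k. k > 0 \<and> (\<forall>p. prime p \<longrightarrow> p dvd k \<longrightarrow> q < p)}"

text \<open>A family of sets $A_x$, $x \in (0,\infty)$, is a total function on the reals; only its values
  at positive arguments are meaningful.\<close>

definition pi_count :: "(real \<Rightarrow> 'a set) \<Rightarrow> ('a \<Rightarrow> nat) \<Rightarrow> real \<Rightarrow> nat \<Rightarrow> nat" where
  "pi_count A n x \<delta> = card {a \<in> A x. \<delta> dvd n a}"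

text \<open>A tuple $(d_1,\dots,d_m)$ is an extensional function on the index set $\{1,\dots,m\}$.\<close>

definition rough_lcm_tuples :: "nat \<Rightarrow> nat \<Rightarrow> real \<Rightarrow> (nat \<Rightarrow> nat) set" where
  "rough_lcm_tuples q m x =
     {d \<in> {1..m} \<rightarrow>\<^sub>E {k. 0 < k \<and> real k \<le> x}. (LCM i\<in>{1..m}. d i) \<in> rough_nats q}"

end

(* Truncate to d_i \<le> x^(c1/m), so that lcm(d_1,...,d_m) \<le> x^c1 stays in the range of (L).
   Since d(n)^m counts all m-tuples of divisors of n, summing it over A_x and interchanging
   the sums bounds the moment below by the sum of pi(x, lcm) over the truncated tuples;
   (L) followed by (L-1) at x^(c1/m), whose logarithm is (c1/m) log x, finishes. *)
theory Submission
  imports Defs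
begin

lemma finite_rough_lcm_tuples: "finite (rough_lcm_tuples q m x)"
proof -
  have "{k::nat. 0 < k \<and> real k \<le> x} \<subseteq> {..nat \<lfloor>x\<rfloor>}"
    by (auto simp: le_nat_floor)
  then have "finite {k::nat. 0 < k \<and> real k \<le> x}"
    using finite_subset by blast
  then have "finite ({1..m} \<rightarrow>\<^sub>E {k. 0 < k \<and> real k \<le> x})"
    by (intro finite_PiE) auto
  then show ?thesis
    unfolding rough_lcm_tuples_def by (rule rev_finite_subset) auto
qed

text \<open>The product is a common multiple of the entries. Positivity of the entries makes it
  nonzero, so that divisibility gives an inequality.\<close>

lemma Lcm_image_le_prod:
  fixes d :: "'i \<Rightarrow> nat"
  assumes "finite I" and "\<And>i. i \<in> I \<Longrightarrow> 0 < d i"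
  shows "(LCM i\<in>I. d i) \<le> (\<Prod>i\<in>I. d i)"
proof (rule dvd_imp_le)
  show "(LCM i\<in>I. d i) dvd (\<Prod>i\<in>I. d i)"
    using assms(1) by (intro Lcm_least) auto
  show "0 < (\<Prod>i\<in>I. d i)"
    using assms(2) by (intro prod_pos) auto
qed

text \<open>The lcm is bounded crudely by the product of the m entries. This loss of an exponent m
  is what forces the truncation exponent \<open>c1 / m\<close> later.\<close>

lemma rough_lcm_tuples_lcm_le:
  assumes "d \<in> rough_lcm_tuples q m x"
  shows "real (LCM i\<in>{1..m}. d i) \<le> x ^ m"
proof -
  have d: "0 < d i \<and> real (d i) \<le> x" if "i \<in> {1..m}" for i
    using assms that unfolding rough_lcm_tuples_def by (auto simp: PiE_iff)
  have "real (LCM i\<in>{1..m}. d i) \<le> real (\<Prod>i\<in>{1..m}. d i)"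
    using Lcm_image_le_prod[of "{1..m}" d] d by (simp only: of_nat_le_iff) blast
  also have "\<dots> \<le> (\<Prod>i\<in>{1..m}. x)"
    unfolding of_nat_prod using d by (intro prod_mono) auto
  finally show ?thesis by simp
qed

text \<open>An lcm divides \<open>k\<close> exactly when every entry does, so these tuples are among
  the m-tuples of divisors of \<open>k\<close>. The size bound and roughness only discard
  tuples.\<close>

lemma card_rough_lcm_tuples_dvd_le:
  assumes "0 < k"
  shows "card {d \<in> rough_lcm_tuples q m x. (LCM i\<in>{1..m}. d i) dvd k} \<le> divisor_count k ^ m"
proof -
  have "{d \<in> rough_lcm_tuples q m x. (LCM i\<in>{1..m}. d i) dvd k} \<subseteq> {1..m} \<rightarrow>\<^sub>E {j. j dvd k}"
    unfolding rough_lcm_tuples_def subset_iff mem_Collect_eq PiE_iff Lcm_dvd_iff by blast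
  moreover have "finite ({1..m} \<rightarrow>\<^sub>E {j. j dvd k})"
    \<comment> \<open>Every number divides 0, so the set of divisors is finite only because
      \<open>k\<close> is positive.\<close>
    using assms by (intro finite_PiE) simp_all
  ultimately have "card {d \<in> rough_lcm_tuples q m x. (LCM i\<in>{1..m}. d i) dvd k}
      \<le> card ({1..m} \<rightarrow>\<^sub>E {j. j dvd k})"
    by (rule card_mono[rotated])
  then show ?thesis
    by (simp add: card_PiE divisor_count_def)
qed

text \<open>Count the pairs of a tuple d and an a in \<open>A x\<close> with lcm(d) dividing
  \<open>n a\<close> in two ways: the left side fixes d first, and fixing a first allows the
  pointwise bound by \<open>divisor_count (n a) ^ m\<close>. The cutoff \<open>y\<close> is
  independent of \<open>x\<close>.\<close>

lemma sum_pi_count_le_divisor_moment: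
  assumes fin: "finite (A x)" and pos: "\<And>a. a \<in> A x \<Longrightarrow> 0 < n a"
  shows "(\<Sum>d\<in>rough_lcm_tuples q m y. pi_count A n x (LCM i\<in>{1..m}. d i))
    \<le> (\<Sum>a\<in>A x. divisor_count (n a) ^ m)"
proof -
  have "(\<Sum>d\<in>rough_lcm_tuples q m y. pi_count A n x (LCM i\<in>{1..m}. d i))
      = (\<Sum>a\<in>A x. card {d \<in> rough_lcm_tuples q m y. (LCM i\<in>{1..m}. d i) dvd n a})"
    unfolding pi_count_def
    by (rule sum_multicount_gen[symmetric]) (simp_all add: fin finite_rough_lcm_tuples)
  also have "\<dots> \<le> (\<Sum>a\<in>A x. divisor_count (n a) ^ m)"
    using pos by (intro sum_mono card_rough_lcm_tuples_dvd_le)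
  finally show ?thesis .
qed

theorem theorem1p5:
  fixes m s q :: nat
    and A :: "real \<Rightarrow> 'a set"
    and n :: "'a \<Rightarrow> nat"
    and \<rho> :: "nat \<Rightarrow> real"
  assumes m: "m \<ge> 1" and s: "s \<ge> 1" and q: "prime q"
    and A_finite: "\<And>x. x > 0 \<Longrightarrow> finite (A x)"
    and A_mono: "\<And>x y. 0 < x \<Longrightarrow> x \<le> y \<Longrightarrow> A x \<subseteq> A y"
    and A_infinite: "infinite (\<Union>x\<in>{0<..}. A x)"
    and n_pos: "\<And>a. a \<in> (\<Union>x\<in>{0<..}. A x) \<Longrightarrow> n a > 0"
    and \<rho>_pos: "\<And>\<delta>. \<delta> \<in> rough_nats q \<Longrightarrow> \<rho> \<delta> > 0"
    and L1: "\<exists>C>0. \<forall>x\<ge>2.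
      (\<Sum>d\<in>rough_lcm_tuples q m x. 1 / \<rho> (LCM i\<in>{1..m}. d i))
        \<ge> C * ln x ^ (s * (2 ^ m - 1))"
    and L: "\<exists>c1. 0 < c1 \<and> c1 < 1 \<and> (\<exists>C>0. \<forall>x>0. \<forall>\<delta>\<in>rough_nats q.
      1 \<le> \<delta> \<longrightarrow> real \<delta> \<le> x powr c1 \<longrightarrow>
        real (pi_count A n x \<delta>) \<ge> C * (1 / \<rho> \<delta>) * real (card (A x)))"
  shows "\<exists>C>0. \<forall>\<^sub>F x in at_top.
      (\<Sum>a\<in>A x. real (divisor_count (n a)) ^ m)
        \<ge> C * real (card (A x)) * ln x ^ (s * (2 ^ m - 1))"
proof -
  let ?K = "s * (2 ^ m - 1)"
  let ?lcm = "\<lambda>d. LCM i\<in>{1..m}. d i :: nat"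
  obtain C1 where "C1 > 0"
    and C1: "\<And>x. x \<ge> 2 \<Longrightarrow> (\<Sum>d\<in>rough_lcm_tuples q m x. 1 / \<rho> (?lcm d)) \<ge> C1 * ln x ^ ?K"
    using L1 by blast
  obtain c1 C2 where "c1 > 0" and "C2 > 0"
    and C2: "\<And>x \<delta>. x > 0 \<Longrightarrow> \<delta> \<in> rough_nats q \<Longrightarrow> 1 \<le> \<delta> \<Longrightarrow> real \<delta> \<le> x powr c1 \<Longrightarrow>
      C2 * (1 / \<rho> \<delta>) * real (card (A x)) \<le> real (pi_count A n x \<delta>)"
    using L by blast
  define e where "e = c1 / real m"
  have "e > 0"
    using m \<open>c1 > 0\<close> by (simp add: e_def)
  \<comment> \<open>The threshold \<open>2 powr (1 / e)\<close> is the point from which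
    \<open>x powr e\<close> is at least 2, as (L-1) requires.\<close>
  have bound: "C2 * C1 * e ^ ?K * real (card (A x)) * ln x ^ ?K
      \<le> (\<Sum>a\<in>A x. real (divisor_count (n a)) ^ m)" if x: "x \<ge> 2 powr (1 / e)" for x
  proof -
    have "x > 0"
      using x by (rule less_le_trans[rotated]) simp
    have "(2 powr (1 / e)) powr e \<le> x powr e"
      using x \<open>e > 0\<close> by (intro powr_mono2) auto
    then have y2: "x powr e \<ge> 2"
      using \<open>e > 0\<close> by (simp add: powr_powr)
    have ym: "(x powr e) ^ m = x powr c1"
      using m \<open>x > 0\<close> by (simp add: e_def powr_power)
    \<comment> \<open>Shrinking the range to \<open>x powr e\<close> costs only the constant factor
      \<open>e ^ ?K\<close>.\<close>
    have "C1 * e ^ ?K * ln x ^ ?K = C1 * ln (x powr e) ^ ?K"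
      using \<open>x > 0\<close> by (simp add: ln_powr power_mult_distrib)
    also have "\<dots> \<le> (\<Sum>d\<in>rough_lcm_tuples q m (x powr e). 1 / \<rho> (?lcm d))"
      by (rule C1[OF y2])
    finally have "C2 * real (card (A x)) * (C1 * e ^ ?K * ln x ^ ?K)
        \<le> C2 * real (card (A x)) * (\<Sum>d\<in>rough_lcm_tuples q m (x powr e). 1 / \<rho> (?lcm d))"
      using \<open>C2 > 0\<close> by (intro mult_left_mono) auto
    also have "\<dots> = (\<Sum>d\<in>rough_lcm_tuples q m (x powr e).
        C2 * (1 / \<rho> (?lcm d)) * real (card (A x)))"
      unfolding sum_distrib_left by (intro sum.cong) auto
    \<comment> \<open>(L) is applied to each tuple separately, with \<delta> its lcm;
      \<open>e * real m = c1\<close> puts \<delta> in the admissible range.\<close>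
    also have "\<dots> \<le> (\<Sum>d\<in>rough_lcm_tuples q m (x powr e). real (pi_count A n x (?lcm d)))"
    proof (rule sum_mono)
      fix d assume d: "d \<in> rough_lcm_tuples q m (x powr e)"
      then have rough: "?lcm d \<in> rough_nats q"
        by (simp add: rough_lcm_tuples_def)
      moreover have "1 \<le> ?lcm d"
        using rough unfolding rough_nats_def by (simp add: Suc_le_eq)
      moreover have "real (?lcm d) \<le> x powr c1"
        using rough_lcm_tuples_lcm_le[OF d] ym by simp
      ultimately show "C2 * (1 / \<rho> (?lcm d)) * real (card (A x))
          \<le> real (pi_count A n x (?lcm d))"
        by (rule C2[OF \<open>x > 0\<close>])
    qed
    also have "\<dots> \<le> (\<Sum>a\<in>A x. real (divisor_count (n a)) ^ m)"
    proof -
      \<comment> \<open>Since \<open>x > 0\<close>, \<open>A x\<close> lies in the union on which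
        \<open>n\<close> is positive.\<close>
      have "0 < n a" if "a \<in> A x" for a
        using n_pos that \<open>x > 0\<close> by blast
      then have "(\<Sum>d\<in>rough_lcm_tuples q m (x powr e). pi_count A n x (?lcm d))
          \<le> (\<Sum>a\<in>A x. divisor_count (n a) ^ m)"
        by (intro sum_pi_count_le_divisor_moment A_finite \<open>x > 0\<close>)
      then have "real (\<Sum>d\<in>rough_lcm_tuples q m (x powr e). pi_count A n x (?lcm d))
          \<le> real (\<Sum>a\<in>A x. divisor_count (n a) ^ m)"
        by (rule of_nat_mono)
      then show ?thesis
        by (simp only: of_nat_sum of_nat_power)
    qed
    finally show ?thesis
      by (simp add: mult_ac)
  qed
  show ?thesis
  proof (intro exI conjI)
    show "C2 * C1 * e ^ ?K > 0"
      using \<open>C1 > 0\<close> \<open>C2 > 0\<close> \<open>e > 0\<close> by simp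
    show "\<forall>\<^sub>F x in at_top. (\<Sum>a\<in>A x. real (divisor_count (n a)) ^ m)
        \<ge> C2 * C1 * e ^ ?K * real (card (A x)) * ln x ^ ?K"
      using eventually_ge_at_top[of "2 powr (1 / e)"] by eventually_elim (rule bound)
  qed
qed

end
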